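(* Let $G=(V,E)$ be a connected amply regular graph with parameters $(n,d,\alpha,\beta)$ such that $\beta>\alpha\geq 1$. Then the Lin--Lu--Yau curvature $\kappa(x,y)$ of any edge $xy\in E$ satisfies \[ \kappa(x,y)\geq\frac{3}{d}. \]
   Context: Graphs are finite and simple. An amply regular graph with parameters $(n,d,\alpha,\beta)$ is a $d$-regular graph on $n$ vertices such that (i) any two adjacent vertices have exactly $\alpha$ common neighbors, and (ii) any two vertices at distance $2$ have exactly $\beta$ common neighbors. Let $\mathrm{dist}(x,y)$ denote the combinatorial distance, i.e. the length of a shortest path connecting $x$ and $y$. For two probability measures $\mu_1,\mu_2$ on $V$, the Wasserstein distance is \[ W(\mu_1,\mu_2)=\inf_{\pi}\sum_{y\in V}\sum_{x\in V}\mathrm{dist}(x,y)\,\pi(x,y), \] where the infimum is over all maps $\pi:V\times V\to[0,1]$ with $\mu_1(x)=\sum_{z\in V}\pi(x,z)$ and $\mu_2(y)=\sum_{z\in V}\pi(z,y)$ for all $x,y\in V$. For $p\in[0,1]$ and $x\in V$, let $\mu_x^p$ be the probability measure with $\mu_x^p(x)=p$, $\mu_x^p(v)=\frac{1-p}{\deg(x)}$ if $v$ is adjacent to $x$, and $\mu_x^p(v)=0$ otherwise. The $p$-Ollivier--Ricci curvature of distinct vertices $x,y$ is $\kappa_p(x,y)=1-\frac{W(\mu_x^p,\mu_y^p)}{\mathrm{dist}(x,y)}$, and the Lin--Lu--Yau curvature is $\kappa(x,y)=\lim_{p\to 1}\frac{\kappa_p(x,y)}{1-p}$. *)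

theory Defs
  imports Complex_Main "Graph_Theory.Graph_Theory"
begin

text \<open>
  A finite simple graph is a \<open>pair_graph\<close>: a finite, loop-free, symmetric digraph whose arcs are
  pairs of vertices, so that the edge \<open>xy\<close> is represented by the two arcs \<open>(x, y)\<close> and \<open>(y, x)\<close>.
\<close>

definition gdist :: "'a pair_pre_digraph \<Rightarrow> 'a \<Rightarrow> 'a \<Rightarrow> nat" where
  "gdist G x y = Inf {vwalk_length p | p. vpath p (with_proj G) \<and> hd p = x \<and> last p = y}"
  \<comment> \<open>If \<open>x\<close> and \<open>y\<close> lie in different components, the value is \<open>Inf {} = 0\<close>.\<close>

definition common_neighbors :: "'a pair_pre_digraph \<Rightarrow> 'a \<Rightarrow> 'a \<Rightarrow> 'a set" where
  "common_neighbors G x y = {z \<in> pverts G. (x, z) \<in> parcs G \<and> (y, z) \<in> parcs G}"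

definition amply_regular :: "'a pair_pre_digraph \<Rightarrow> nat \<Rightarrow> nat \<Rightarrow> nat \<Rightarrow> nat \<Rightarrow> bool" where
  "amply_regular G n d \<alpha> \<beta> \<longleftrightarrow>
     pair_graph G \<and>
     card (pverts G) = n \<and>
     (\<forall>x\<in>pverts G. out_degree (with_proj G) x = d) \<and>
     (\<forall>x\<in>pverts G. \<forall>y\<in>pverts G. (x, y) \<in> parcs G \<longrightarrow> card (common_neighbors G x y) = \<alpha>) \<and>
     (\<forall>x\<in>pverts G. \<forall>y\<in>pverts G. gdist G x y = 2 \<longrightarrow> card (common_neighbors G x y) = \<beta>)"

text \<open>
  Probability measures on the finite vertex set are given by their mass functions; only the values
  on \<open>pverts G\<close> matter.
\<close>

definition couplings ::
  "'a pair_pre_digraph \<Rightarrow> ('a \<Rightarrow> real) \<Rightarrow> ('a \<Rightarrow> real) \<Rightarrow> ('a \<Rightarrow> 'a \<Rightarrow> real) set" where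
  "couplings G \<mu>1 \<mu>2 = {\<pi>.
     (\<forall>x\<in>pverts G. \<forall>y\<in>pverts G. \<pi> x y \<in> {0..1}) \<and>
     (\<forall>x\<in>pverts G. \<mu>1 x = (\<Sum>z\<in>pverts G. \<pi> x z)) \<and>
     (\<forall>y\<in>pverts G. \<mu>2 y = (\<Sum>z\<in>pverts G. \<pi> z y))}"

definition wasserstein :: "'a pair_pre_digraph \<Rightarrow> ('a \<Rightarrow> real) \<Rightarrow> ('a \<Rightarrow> real) \<Rightarrow> real" where
  "wasserstein G \<mu>1 \<mu>2 =
     (INF \<pi>\<in>couplings G \<mu>1 \<mu>2. \<Sum>y\<in>pverts G. \<Sum>x\<in>pverts G. real (gdist G x y) * \<pi> x y)"

definition lazy_measure :: "'a pair_pre_digraph \<Rightarrow> real \<Rightarrow> 'a \<Rightarrow> 'a \<Rightarrow> real" where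
  "lazy_measure G p x v =
     (if v = x then p
      else if (x, v) \<in> parcs G then (1 - p) / real (out_degree (with_proj G) x)
      else 0)"

definition ollivier_curvature :: "'a pair_pre_digraph \<Rightarrow> real \<Rightarrow> 'a \<Rightarrow> 'a \<Rightarrow> real" where
  "ollivier_curvature G p x y =
     1 - wasserstein G (lazy_measure G p x) (lazy_measure G p y) / real (gdist G x y)"

definition lly_curvature :: "'a pair_pre_digraph \<Rightarrow> 'a \<Rightarrow> 'a \<Rightarrow> real" where
  "lly_curvature G x y = Lim (at_left 1) (\<lambda>p. ollivier_curvature G p x y / (1 - p))"
  \<comment> \<open>The limit is one-sided because the idleness parameter ranges over \<open>[0, 1]\<close>.\<close>

end

theory Submission
  imports Defs "HOL-Analysis.Elementary_Topology"
begin

text \<open>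
  Every neighbour of \<open>x\<close> other than \<open>y\<close> has \<open>\<beta> - 1\<close> neighbours in \<open>N(y) - {x}\<close>, except that a common
  neighbour of \<open>x\<close> and \<open>y\<close> has only \<open>\<alpha> - 1\<close> of them. Joining each common neighbour to itself with
  multiplicity \<open>\<beta> - \<alpha>\<close> makes the bipartite graph between \<open>N(x) - {y}\<close> and \<open>N(y) - {x}\<close> regular of
  degree \<open>\<beta> - 1\<close>, so spreading the mass uniformly over its edges is a transport plan. Its
  stationary part on the common neighbours is \<open>\<alpha>(\<beta> - \<alpha>)/(\<beta> - 1) \<ge> 1\<close> units of \<open>(1 - p)/d\<close>; two
  more units rest at \<open>x\<close> and \<open>y\<close>, and all other mass moves by one step. Hence
  \<open>\<kappa>\<^sub>p(x,y) \<ge> 3(1 - p)/d\<close> for \<open>p\<close> near \<open>1\<close>. The limit exists because, by convexity of the Wasserstein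
  distance, \<open>\<kappa>\<^sub>p(x,y)/(1 - p)\<close> is nondecreasing in \<open>p\<close>.
\<close>

subsection \<open>Short distances\<close>

lemma gdist_le:
  assumes "vpath p (with_proj G)" "hd p = x" "last p = y"
  shows "gdist G x y \<le> length p - 1"
  unfolding gdist_def using assms by (intro cInf_lower) auto

text \<open>A connecting path must be supplied: otherwise the infimum is over the empty set and no
  path attains it.\<close>

lemma gdist_attained:
  assumes "vpath q (with_proj G)" "hd q = x" "last q = y"
  obtains p where "vpath p (with_proj G)" "hd p = x" "last p = y" "gdist G x y = length p - 1"
proof -
  have "gdist G x y \<in> {vwalk_length p | p. vpath p (with_proj G) \<and> hd p = x \<and> last p = y}"
    unfolding gdist_def using assms by (intro Inf_nat_def1) blast
  then show thesis using that by auto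
qed

lemma gdist_self:
  assumes "x \<in> pverts G"
  shows "gdist G x x = 0"
  using gdist_le[of "[x]" G x x] assms by (auto simp: vpath_def vwalk_def)

context pair_graph
begin

lemma arc_sym: "(u, v) \<in> parcs G \<longleftrightarrow> (v, u) \<in> parcs G"
  using pair_sym_arcs by (auto simp: symmetric_def sym_def)

lemma arc_irrefl: "(u, u) \<notin> parcs G"
  using pair_no_loops by fastforce

lemma vpath_arc:
  assumes "(u, v) \<in> parcs G"
  shows "vpath [u, v] (with_proj G)"
  using assms arc_irrefl wellformed' by (auto simp: vpath_def vwalk_def)

lemma gdist_arc:
  assumes "(u, v) \<in> parcs G"
  shows "gdist G u v = 1"
proof -
  obtain p where p: "vpath p (with_proj G)" "hd p = u" "last p = v" "gdist G u v = length p - 1"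
    by (rule gdist_attained[OF vpath_arc[OF assms]]) auto
  have "u \<noteq> v"
    using assms arc_irrefl by blast
  \<comment> \<open>A path with k edges lists k + 1 vertices; the empty list is no walk, and a
    single vertex would force \<open>u = v\<close>.\<close>
  then have "length p \<noteq> 0" "length p \<noteq> 1"
    using p by (auto simp: length_Suc_conv vpath_def vwalk_def)
  moreover have "gdist G u v \<le> 1"
    using gdist_le[OF vpath_arc[OF assms], of u v] by simp
  ultimately show ?thesis
    using p(4) by linarith
qed

text \<open>Makes condition (ii) of ample regularity applicable to nonadjacent vertices with a
  common neighbor.\<close>

lemma gdist_eq_2:
  assumes "(u, w) \<in> parcs G" "(w, v) \<in> parcs G" "u \<noteq> v" "(u, v) \<notin> parcs G"
  shows "gdist G u v = 2"
proof -
  have path: "vpath [u, w, v] (with_proj G)"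
    using assms arc_irrefl wellformed' by (auto simp: vpath_def vwalk_def)
  obtain p where p: "vpath p (with_proj G)" "hd p = u" "last p = v" "gdist G u v = length p - 1"
    by (rule gdist_attained[OF path]) auto
  have "length p \<noteq> 0" "length p \<noteq> 1" "length p \<noteq> 2"
    using p assms by (auto simp: length_Suc_conv vpath_def vwalk_def numeral_2_eq_2)
  moreover have "gdist G u v \<le> 2"
    using gdist_le[OF path, of u v] by simp
  ultimately show ?thesis
    using p(4) by linarith
qed

lemma card_nbrs: "card {v \<in> pverts G. (u, v) \<in> parcs G} = out_degree (with_proj G) u"
proof -
  have "out_arcs (with_proj G) u = Pair u ` {v \<in> pverts G. (u, v) \<in> parcs G}"
    using wellformed' by (auto simp: out_arcs_def)
  then show ?thesis
    by (simp add: out_degree_def card_image inj_on_def)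
qed

lemma out_degree_pos:
  assumes "(x, y) \<in> parcs G"
  shows "out_degree (with_proj G) x > 0"
proof -
  have "y \<in> {v \<in> pverts G. (x, v) \<in> parcs G}"
    using assms wellformed' by auto
  then show ?thesis
    unfolding card_nbrs[symmetric] using pair_finite_verts by (auto simp: card_gt_0_iff)
qed

end

subsection \<open>Couplings and the Wasserstein distance\<close>

definition transport_cost :: "'a pair_pre_digraph \<Rightarrow> ('a \<Rightarrow> 'a \<Rightarrow> real) \<Rightarrow> real" where
  "transport_cost G \<pi> = (\<Sum>v\<in>pverts G. \<Sum>u\<in>pverts G. real (gdist G u v) * \<pi> u v)"

lemma wasserstein_eq: "wasserstein G \<mu> \<nu> = (INF \<pi>\<in>couplings G \<mu> \<nu>. transport_cost G \<pi>)"
  by (simp add: wasserstein_def transport_cost_def)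

lemma coupling_nonneg:
  assumes "\<pi> \<in> couplings G \<mu> \<nu>" "u \<in> pverts G" "v \<in> pverts G"
  shows "\<pi> u v \<ge> 0"
  using assms by (auto simp: couplings_def)

lemma couplingsI:
  assumes "finite (pverts G)"
    and nonneg: "\<And>u v. u \<in> pverts G \<Longrightarrow> v \<in> pverts G \<Longrightarrow> \<pi> u v \<ge> 0"
    and row: "\<And>u. u \<in> pverts G \<Longrightarrow> (\<Sum>v\<in>pverts G. \<pi> u v) = \<mu> u"
    and col: "\<And>v. v \<in> pverts G \<Longrightarrow> (\<Sum>u\<in>pverts G. \<pi> u v) = \<nu> v"
    and le1: "\<And>u. u \<in> pverts G \<Longrightarrow> \<mu> u \<le> 1"
  shows "\<pi> \<in> couplings G \<mu> \<nu>"
proof -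
  have "\<pi> u v \<le> 1" if "u \<in> pverts G" "v \<in> pverts G" for u v
    using member_le_sum[of v "pverts G" "\<pi> u"] assms that by force
  then show ?thesis
    using assms by (auto simp: couplings_def)
qed

lemma transport_cost_nonneg:
  assumes "\<pi> \<in> couplings G \<mu> \<nu>"
  shows "transport_cost G \<pi> \<ge> 0"
  unfolding transport_cost_def using coupling_nonneg[OF assms] by (intro sum_nonneg) auto

lemma wasserstein_le:
  assumes "\<pi> \<in> couplings G \<mu> \<nu>"
  shows "wasserstein G \<mu> \<nu> \<le> transport_cost G \<pi>"
  unfolding wasserstein_eq using assms transport_cost_nonneg
  by (intro cINF_lower bdd_belowI2[of _ 0]) blast+

text \<open>An infimum of reals over the empty set says nothing, so nonemptiness is required; it is
  carried along as \<open>ne\<close> until the explicit plan provides it.\<close>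

lemma wasserstein_ge:
  assumes "couplings G \<mu> \<nu> \<noteq> {}"
    and "\<And>\<pi>. \<pi> \<in> couplings G \<mu> \<nu> \<Longrightarrow> c \<le> transport_cost G \<pi>"
  shows "c \<le> wasserstein G \<mu> \<nu>"
  unfolding wasserstein_eq using assms by (intro cINF_greatest)

lemma transport_cost_mix:
  "transport_cost G (\<lambda>u v. s * \<pi> u v + t * \<rho> u v)
     = s * transport_cost G \<pi> + t * transport_cost G \<rho>"
  by (simp add: transport_cost_def sum.distrib sum_distrib_left algebra_simps)

lemma couplings_mix:
  assumes "\<pi> \<in> couplings G \<mu> \<nu>" "\<rho> \<in> couplings G \<mu>' \<nu>'" "0 \<le> t" "t \<le> 1"
  shows "(\<lambda>u v. t * \<pi> u v + (1 - t) * \<rho> u v)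
           \<in> couplings G (\<lambda>u. t * \<mu> u + (1 - t) * \<mu>' u) (\<lambda>v. t * \<nu> v + (1 - t) * \<nu>' v)"
  using assms
  by (auto simp: couplings_def sum.distrib sum_distrib_left intro!: convex_bound_le)

text \<open>At idleness 1 the lazy measures are point masses, and moving \<open>x\<close> to
  \<open>y\<close> is the plan that gets mixed in below.\<close>

lemma dirac_coupling:
  assumes "finite (pverts G)" "x \<in> pverts G" "y \<in> pverts G"
  shows "(\<lambda>u v. if u = x \<and> v = y then 1 else 0)
           \<in> couplings G (lazy_measure G 1 x) (lazy_measure G 1 y)" (is "?\<pi> \<in> _")
    and "transport_cost G (\<lambda>u v. if u = x \<and> v = y then 1 else 0) = real (gdist G x y)"
proof -
  have row: "(\<Sum>v\<in>pverts G. ?\<pi> u v) = (if u = x then 1 else 0)" for u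
    using assms by (cases "u = x") auto
  have col: "(\<Sum>u\<in>pverts G. ?\<pi> u v) = (if v = y then 1 else 0)" for v
    using assms by (cases "v = y") auto
  show "?\<pi> \<in> couplings G (lazy_measure G 1 x) (lazy_measure G 1 y)"
    using assms(1) row col by (intro couplingsI) (auto simp: lazy_measure_def)
  have "transport_cost G ?\<pi> = (\<Sum>v\<in>pverts G. if v = y then real (gdist G x y) else 0)"
    unfolding transport_cost_def
    using assms by (intro sum.cong) (auto simp: if_distrib[of "\<lambda>z. _ * z"] cong: if_cong)
  then show "transport_cost G ?\<pi> = real (gdist G x y)"
    using assms by simp
qed

text \<open>The measure is affine in the idleness. For q between p and 1 this is a convex
  combination with the point mass at \<open>x\<close>.\<close>

lemma lazy_measure_mix:
  assumes "p < 1"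
  defines "t \<equiv> \<lambda>q. (1 - q) / (1 - p)"
  shows "lazy_measure G q x v = t q * lazy_measure G p x v + (1 - t q) * lazy_measure G 1 x v"
proof (cases "v = x")
  case True
  have "t q * p + (1 - t q) = 1 - t q * (1 - p)" by (simp add: algebra_simps)
  then show ?thesis
    using assms True by (simp add: lazy_measure_def)
next
  case False
  then show ?thesis
    using assms by (auto simp: lazy_measure_def)
qed

subsection \<open>Existence of the limit defining the curvature\<close>

context pair_graph
begin

lemma sum_lazy_measure:
  assumes "(x, y) \<in> parcs G"
  shows "(\<Sum>v\<in>pverts G. lazy_measure G p x v) = 1"
proof -
  let ?N = "{v \<in> pverts G. (x, v) \<in> parcs G}"
  have x: "x \<in> pverts G"
    using assms wellformed' by auto
  have "(\<Sum>v\<in>pverts G. lazy_measure G p x v)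
      = p + (\<Sum>v\<in>pverts G - {x}. lazy_measure G p x v)"
    using x pair_finite_verts by (simp add: sum.remove lazy_measure_def)
  also have "(\<Sum>v\<in>pverts G - {x}. lazy_measure G p x v)
      = (\<Sum>v\<in>?N. (1 - p) / real (out_degree (with_proj G) x))"
    using pair_finite_verts arc_irrefl
    by (intro sum.mono_neutral_cong_right) (auto simp: lazy_measure_def)
  also have "\<dots> = 1 - p"
    using out_degree_pos[OF assms] by (simp add: card_nbrs)
  finally show ?thesis
    by simp
qed

text \<open>Mixing any plan for p with the point-mass plan of cost 1 gives W_q \<le> t W_p + (1 -
  t), hence t (1 - W_p) \<le> 1 - W_q; then divide by 1 - q = t (1 - p).\<close>

lemma ollivier_ratio_mono:
  assumes arc: "(x, y) \<in> parcs G" and pq: "p \<le> q" "q < 1"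
    and ne: "couplings G (lazy_measure G p x) (lazy_measure G p y) \<noteq> {}"
  shows "ollivier_curvature G p x y / (1 - p) \<le> ollivier_curvature G q x y / (1 - q)"
proof -
  define t where "t = (1 - q) / (1 - p)"
  have t: "0 < t" "t \<le> 1"
    using pq by (auto simp: t_def)
  let ?W = "\<lambda>p. wasserstein G (lazy_measure G p x) (lazy_measure G p y)"
  have xy: "x \<in> pverts G" "y \<in> pverts G"
    using arc wellformed' by auto
  have mix: "lazy_measure G q z = (\<lambda>v. t * lazy_measure G p z v + (1 - t) * lazy_measure G 1 z v)" for z
    unfolding t_def using pq by (intro ext lazy_measure_mix) auto
  \<comment> \<open>Solved for W_p, so that it suffices to bound the cost of each single plan from
    below.\<close>
  have "(?W q - (1 - t)) / t \<le> ?W p"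
  proof (rule wasserstein_ge[OF ne])
    fix \<pi> assume \<pi>: "\<pi> \<in> couplings G (lazy_measure G p x) (lazy_measure G p y)"
    have "?W q \<le> transport_cost G (\<lambda>u v. t * \<pi> u v + (1 - t) * (if u = x \<and> v = y then 1 else 0))"
      unfolding mix using \<pi> dirac_coupling(1)[OF pair_finite_verts xy] t
      by (intro wasserstein_le couplings_mix) auto
    also have "\<dots> = t * transport_cost G \<pi> + (1 - t)"
      using dirac_coupling(2)[OF pair_finite_verts xy] gdist_arc[OF arc]
      by (simp add: transport_cost_mix)
    finally show "(?W q - (1 - t)) / t \<le> transport_cost G \<pi>"
      using t by (simp add: field_simps)
  qed
  then have "t * (1 - ?W p) \<le> 1 - ?W q"
    using t by (simp add: field_simps)
  then show ?thesis
    using pq gdist_arc[OF arc] by (simp add: ollivier_curvature_def t_def field_simps)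
qed

text \<open>Boundedness turns monotonicity into convergence. Of the mass p at \<open>x\<close>, at
  most 1 - p can end outside \<open>y\<close>, so at least 2p - 1 travels from \<open>x\<close> to
  \<open>y\<close> at distance 1.\<close>

lemma ollivier_ratio_le_2:
  assumes arc: "(x, y) \<in> parcs G" and p: "p < 1"
    and ne: "couplings G (lazy_measure G p x) (lazy_measure G p y) \<noteq> {}"
  shows "ollivier_curvature G p x y / (1 - p) \<le> 2"
proof -
  let ?V = "pverts G"
  have xy: "x \<in> ?V" "y \<in> ?V"
    using arc wellformed' by auto
  have "2 * p - 1 \<le> wasserstein G (lazy_measure G p x) (lazy_measure G p y)"
  proof (rule wasserstein_ge[OF ne])
    fix \<pi> assume \<pi>: "\<pi> \<in> couplings G (lazy_measure G p x) (lazy_measure G p y)"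
    note nonneg = coupling_nonneg[OF \<pi>]
    have row: "(\<Sum>v\<in>?V. \<pi> x v) = p"
      using \<pi> xy by (force simp: couplings_def lazy_measure_def)
    have col: "(\<Sum>u\<in>?V. \<pi> u y) = p"
      using \<pi> xy by (force simp: couplings_def lazy_measure_def)
    have "1 = (\<Sum>v\<in>?V. lazy_measure G p y v)"
      using sum_lazy_measure arc arc_sym by metis
    also have "\<dots> = (\<Sum>v\<in>?V. \<Sum>u\<in>?V. \<pi> u v)"
      using \<pi> by (intro sum.cong) (auto simp: couplings_def)
    also have "\<dots> = p + (\<Sum>v\<in>?V - {y}. \<Sum>u\<in>?V. \<pi> u v)"
      using sum.remove[OF pair_finite_verts xy(2), of "\<lambda>v. \<Sum>u\<in>?V. \<pi> u v"] col by simp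
    finally have total: "1 = p + (\<Sum>v\<in>?V - {y}. \<Sum>u\<in>?V. \<pi> u v)" .
    have "p - \<pi> x y = (\<Sum>v\<in>?V - {y}. \<pi> x v)"
      using sum.remove[OF pair_finite_verts xy(2), of "\<pi> x"] row by simp
    also have "\<dots> \<le> (\<Sum>v\<in>?V - {y}. \<Sum>u\<in>?V. \<pi> u v)"
      using xy pair_finite_verts nonneg by (intro sum_mono member_le_sum) auto
    finally have "2 * p - 1 \<le> real (gdist G x y) * \<pi> x y"
      using total gdist_arc[OF arc] by simp
    also have "\<dots> \<le> (\<Sum>u\<in>?V. real (gdist G u y) * \<pi> u y)"
      using xy pair_finite_verts nonneg
      by (intro member_le_sum[of x ?V "\<lambda>u. real (gdist G u y) * \<pi> u y"]) auto
    also have "\<dots> \<le> transport_cost G \<pi>"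
      unfolding transport_cost_def using xy pair_finite_verts nonneg
      by (intro member_le_sum[of y ?V "\<lambda>v. \<Sum>u\<in>?V. real (gdist G u v) * \<pi> u v"]
          sum_nonneg) auto
    finally show "2 * p - 1 \<le> transport_cost G \<pi>" .
  qed
  then show ?thesis
    using p gdist_arc[OF arc] by (simp add: ollivier_curvature_def field_simps)
qed

lemma lly_curvature_ge:
  assumes arc: "(x, y) \<in> parcs G" and "a < 1"
    and ne: "\<And>p. a \<le> p \<Longrightarrow> p < 1 \<Longrightarrow> couplings G (lazy_measure G p x) (lazy_measure G p y) \<noteq> {}"
    and ge: "\<And>p. a \<le> p \<Longrightarrow> p < 1 \<Longrightarrow> K \<le> ollivier_curvature G p x y / (1 - p)"
  shows "K \<le> lly_curvature G x y"
proof -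
  let ?h = "\<lambda>p. ollivier_curvature G p x y / (1 - p)"
  \<comment> \<open>A bounded nondecreasing function tends to its supremum from the left. The
    restriction to p \<ge> a is where plans are known to exist.\<close>
  have "(?h \<longlongrightarrow> Sup (?h ` ({..<1} \<inter> {a..}))) (at 1 within ({..<1} \<inter> {a..}))"
    using ollivier_ratio_mono[OF arc _ _ ne] ollivier_ratio_le_2[OF arc _ ne]
    by (intro Lim_left_bound[where K = 2]) auto
  moreover have "at 1 within ({..<1} \<inter> {a..}) = at_left 1"
    using \<open>a < 1\<close> by (intro at_within_nhd[of _ "{a<..}"]) auto
  ultimately have lim: "(?h \<longlongrightarrow> Sup (?h ` ({..<1} \<inter> {a..}))) (at_left 1)"
    by simp
  have "eventually (\<lambda>p. a < p \<and> p < 1) (at_left 1)"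
    using \<open>a < 1\<close> eventually_at_left_field by blast
  then have "eventually (\<lambda>p. K \<le> ?h p) (at_left 1)"
    by eventually_elim (use ge in auto)
  then have "K \<le> Sup (?h ` ({..<1} \<inter> {a..}))"
    by (intro tendsto_lowerbound[OF lim]) auto
  then show ?thesis
    unfolding lly_curvature_def using tendsto_Lim[OF _ lim] by simp
qed

end

subsection \<open>A transport plan along an edge\<close>

text \<open>Edge multiplicity in the auxiliary bipartite graph divided by its degree \<beta> - 1;
  the diagonal term is the extra edge joining a common neighbor to itself. The subtractions are
  exact when 1 \<le> \<alpha> < \<beta>.\<close>

definition edge_weight :: "'a pair_pre_digraph \<Rightarrow> nat \<Rightarrow> nat \<Rightarrow> 'a \<Rightarrow> 'a \<Rightarrow> real" where
  "edge_weight G \<alpha> \<beta> u v =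
     (if u = v then real (\<beta> - \<alpha>) / real (\<beta> - 1) else 0) +
     (if (u, v) \<in> parcs G then 1 / real (\<beta> - 1) else 0)"

text \<open>Here \<open>c\<close> will be (1 - p)/d, the mass of one neighbor. Vertex
  \<open>x\<close> starts with p and must end with \<open>c\<close>, so it sends p - c to
  \<open>y\<close>, which keeps its own \<open>c\<close>.\<close>

definition edge_plan ::
  "'a pair_pre_digraph \<Rightarrow> nat \<Rightarrow> nat \<Rightarrow> real \<Rightarrow> real \<Rightarrow> 'a \<Rightarrow> 'a \<Rightarrow> 'a \<Rightarrow> 'a \<Rightarrow> real" where
  "edge_plan G \<alpha> \<beta> p c x y u v =
     (if u = x then (if v = x then c else if v = y then p - c else 0)
      else if u = y then (if v = y then c else 0)
      else if (x, u) \<in> parcs G \<and> (y, v) \<in> parcs G \<and> v \<noteq> x then c * edge_weight G \<alpha> \<beta> u v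
      else 0)"

lemma edge_weight_nonneg: "edge_weight G \<alpha> \<beta> u v \<ge> 0"
  by (simp add: edge_weight_def)

context pair_graph
begin

text \<open>Reversing the transport exchanges the roles of \<open>x\<close> and \<open>y\<close>, so
  column sums reduce to row sums.\<close>

lemma edge_plan_swap:
  assumes "x \<noteq> y"
  shows "edge_plan G \<alpha> \<beta> p c x y u v = edge_plan G \<alpha> \<beta> p c y x v u"
  using assms arc_irrefl arc_sym by (auto simp: edge_plan_def edge_weight_def)

end

locale amply_regular_graph = pair_graph +
  fixes n d \<alpha> \<beta> :: nat
  assumes ample: "amply_regular G n d \<alpha> \<beta>" and \<alpha>_pos: "\<alpha> \<ge> 1" and \<alpha>_less: "\<alpha> < \<beta>"
begin

text \<open>Regularity of the auxiliary graph: \<open>x\<close> is a common neighbor of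
  \<open>u\<close> and \<open>y\<close> lying outside \<open>S\<close>, which accounts for the -1.
  If \<open>u\<close> is adjacent to \<open>y\<close>, then (\<beta> - \<alpha>) + (\<alpha> - 1) =
  \<beta> - 1.\<close>

lemma edge_weight_sum:
  assumes arc: "(x, y) \<in> parcs G" and xu: "(x, u) \<in> parcs G" "u \<noteq> y"
  defines "S \<equiv> {v \<in> pverts G. (y, v) \<in> parcs G \<and> v \<noteq> x}"
  shows "(\<Sum>v\<in>S. edge_weight G \<alpha> \<beta> u v) = 1"
proof -
  have V: "x \<in> pverts G" "y \<in> pverts G" "u \<in> pverts G"
    using arc xu wellformed' by auto
  have fin: "finite S"
    using pair_finite_verts by (simp add: S_def)
  have uS: "u \<in> S \<longleftrightarrow> (u, y) \<in> parcs G"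
    using V xu arc_irrefl arc_sym by (auto simp: S_def)
  \<comment> \<open>If \<open>u\<close> is not adjacent to \<open>y\<close>, the path through
    \<open>x\<close> puts them at distance 2.\<close>
  have card: "card (common_neighbors G u y) = (if (u, y) \<in> parcs G then \<alpha> else \<beta>)"
    using ample V gdist_eq_2[of u x y] arc xu arc_sym by (auto simp: amply_regular_def)
  have nbrs: "{v \<in> S. (u, v) \<in> parcs G} = common_neighbors G u y - {x}"
    by (auto simp: S_def common_neighbors_def)
  have x: "x \<in> common_neighbors G u y"
    using V xu arc arc_sym by (auto simp: common_neighbors_def)
  have "finite (common_neighbors G u y)"
    using pair_finite_verts by (simp add: common_neighbors_def)
  with x nbrs card have deg: "card {v \<in> S. (u, v) \<in> parcs G} = (if u \<in> S then \<alpha> - 1 else \<beta> - 1)"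
    by (simp add: uS)
  have "(\<Sum>v\<in>S. edge_weight G \<alpha> \<beta> u v)
      = (if u \<in> S then real (\<beta> - \<alpha>) / real (\<beta> - 1) else 0)
        + real (card {v \<in> S. (u, v) \<in> parcs G}) / real (\<beta> - 1)"
    using fin by (simp add: edge_weight_def sum.distrib flip: sum.inter_filter)
  also have "\<dots> = 1"
    using \<alpha>_pos \<alpha>_less unfolding deg by (auto simp: of_nat_diff field_simps)
  finally show ?thesis .
qed

lemma edge_plan_row:
  assumes arc: "(x, y) \<in> parcs G" and u: "u \<in> pverts G"
  shows "(\<Sum>v\<in>pverts G. edge_plan G \<alpha> \<beta> p ((1 - p) / real d) x y u v) = lazy_measure G p x u"
proof -
  let ?c = "(1 - p) / real d" and ?V = "pverts G"
  let ?S = "{v \<in> ?V. (y, v) \<in> parcs G \<and> v \<noteq> x}"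
  have V: "x \<in> ?V" "y \<in> ?V" and xy: "x \<noteq> y"
    using arc wellformed' arc_irrefl by auto
  have deg: "out_degree (with_proj G) x = d"
    using ample V by (auto simp: amply_regular_def)
  consider "u = x" | "u = y" | "u \<noteq> x" "u \<noteq> y" "(x, u) \<in> parcs G" | "u \<noteq> x" "u \<noteq> y" "(x, u) \<notin> parcs G"
    by blast
  then show ?thesis
  proof cases
    case 1
    then have "(\<Sum>v\<in>?V. edge_plan G \<alpha> \<beta> p ?c x y u v)
        = (\<Sum>v\<in>?V. (if v = x then ?c else 0) + (if v = y then p - ?c else 0))"
      using xy by (intro sum.cong) (auto simp: edge_plan_def)
    then show ?thesis
      using 1 V pair_finite_verts by (simp add: sum.distrib lazy_measure_def)
  next
    case 2
    then show ?thesis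
      using V xy pair_finite_verts arc deg by (simp add: edge_plan_def lazy_measure_def)
  next
    case 3
    then have "(\<Sum>v\<in>?V. edge_plan G \<alpha> \<beta> p ?c x y u v) = (\<Sum>v\<in>?S. ?c * edge_weight G \<alpha> \<beta> u v)"
      using pair_finite_verts
      by (intro sum.mono_neutral_cong_right) (auto simp: edge_plan_def)
    then show ?thesis
      unfolding sum_distrib_left[symmetric] edge_weight_sum[OF arc 3(3,2)]
      using 3 deg by (simp add: lazy_measure_def)
  next
    case 4
    then show ?thesis
      by (simp add: edge_plan_def lazy_measure_def)
  qed
qed

lemma edge_plan_coupling:
  assumes arc: "(x, y) \<in> parcs G" and p: "1 / (real d + 1) \<le> p" "p < 1"
  shows "edge_plan G \<alpha> \<beta> p ((1 - p) / real d) x y \<in> couplings G (lazy_measure G p x) (lazy_measure G p y)"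
proof (rule couplingsI[OF pair_finite_verts])
  let ?c = "(1 - p) / real d"
  have V: "x \<in> pverts G" "y \<in> pverts G" and xy: "x \<noteq> y"
    using arc wellformed' arc_irrefl by auto
  have d: "out_degree (with_proj G) x = d"
    using ample V by (auto simp: amply_regular_def)
  have "0 \<le> p"
    using p(1) by (meson divide_nonneg_nonneg add_nonneg_nonneg of_nat_0_le_iff order_trans zero_le_one)
  have "d > 0"
    using out_degree_pos[OF arc] d by simp
  \<comment> \<open>The lower bound on p says exactly that \<open>?c\<close> \<le> p, so the entry p
    - c is nonnegative.\<close>
  then have c: "0 \<le> ?c" "?c \<le> p"
    using p by (auto simp: field_simps)
  show "edge_plan G \<alpha> \<beta> p ?c x y u v \<ge> 0" for u v
    using c p edge_weight_nonneg[of G \<alpha> \<beta> u v] unfolding edge_plan_def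
    by (auto intro!: mult_nonneg_nonneg divide_nonneg_nonneg)
  show "(\<Sum>v\<in>pverts G. edge_plan G \<alpha> \<beta> p ?c x y u v) = lazy_measure G p x u" if "u \<in> pverts G" for u
    by (rule edge_plan_row[OF arc that])
  show "(\<Sum>u\<in>pverts G. edge_plan G \<alpha> \<beta> p ?c x y u v) = lazy_measure G p y v" if "v \<in> pverts G" for v
    using edge_plan_row[of y x v p] arc_sym arc that edge_plan_swap[OF xy] by simp
  show "lazy_measure G p x u \<le> 1" for u
    using c p d by (auto simp: lazy_measure_def)
qed

lemma edge_plan_cost:
  assumes arc: "(x, y) \<in> parcs G" and p: "1 / (real d + 1) \<le> p" "p < 1"
  shows "transport_cost G (edge_plan G \<alpha> \<beta> p ((1 - p) / real d) x y) \<le> 1 - 3 * (1 - p) / real d"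
proof -
  let ?c = "(1 - p) / real d" and ?V = "pverts G" and ?C = "common_neighbors G x y"
  let ?\<pi> = "edge_plan G \<alpha> \<beta> p ?c x y"
  have V: "x \<in> ?V" "y \<in> ?V" and xy: "x \<noteq> y"
    using arc wellformed' arc_irrefl by auto
  have c: "?c \<ge> 0"
    using p by simp
  \<comment> \<open>Off the diagonal the plan charges only adjacent pairs, so its cost is the total
    mass minus the diagonal mass.\<close>
  have unit: "real (gdist G u v) * ?\<pi> u v = ?\<pi> u v - (if u = v then ?\<pi> u u else 0)"
    if "u \<in> ?V" "v \<in> ?V" for u v
  proof (cases "u = v")
    case True
    then show ?thesis
      using gdist_self[OF that(1)] by simp
  next
    case False
    then have "(u, v) \<in> parcs G \<or> ?\<pi> u v = 0"
      using arc by (auto simp: edge_plan_def edge_weight_def)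
    then show ?thesis
      using False gdist_arc by auto
  qed
  \<comment> \<open>The excess of \<alpha>(\<beta> - \<alpha>) over \<beta> - 1 factors into two
    nonnegative terms; hence the common neighbors together keep at least one unit
    \<open>?c\<close>.\<close>
  have "(\<alpha> - 1) * (\<beta> - 1 - \<alpha>) + (\<beta> - 1) = \<alpha> * (\<beta> - \<alpha>)"
  proof -
    obtain a where "\<alpha> = Suc a" using \<alpha>_pos by (cases \<alpha>) auto
    moreover obtain k where "\<beta> = Suc (\<alpha> + k)" using \<alpha>_less less_iff_Suc_add by blast
    ultimately show ?thesis by (simp add: algebra_simps)
  qed
  then have "\<beta> - 1 \<le> \<alpha> * (\<beta> - \<alpha>)"
    by linarith
  then have "real (\<beta> - 1) \<le> real \<alpha> * real (\<beta> - \<alpha>)"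
    by (metis of_nat_le_iff of_nat_mult)
  then have ratio: "1 \<le> real \<alpha> * (real (\<beta> - \<alpha>) / real (\<beta> - 1))"
    using \<alpha>_pos \<alpha>_less by (simp add: field_simps)
  have finC: "finite ?C" and notC: "x \<notin> ?C" "y \<notin> ?C" and subC: "?C \<subseteq> ?V"
    using pair_finite_verts arc_irrefl by (auto simp: common_neighbors_def)
  have card: "card ?C = \<alpha>"
    using ample V arc by (auto simp: amply_regular_def)
  \<comment> \<open>The three units: one at \<open>x\<close>, one at \<open>y\<close>, and at least
    one on the common neighbors.\<close>
  have "3 * ?c \<le> ?c + (?c + ?c * (real \<alpha> * (real (\<beta> - \<alpha>) / real (\<beta> - 1))))"
  proof -
    have "3 * c \<le> c + (c + c * r)" if "c * 1 \<le> c * r" for c r :: real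
      using that by simp
    then show ?thesis
      using mult_left_mono[OF ratio c] by blast
  qed
  also have "\<dots> = ?\<pi> x x + (?\<pi> y y + (\<Sum>u\<in>?C. ?\<pi> u u))"
  proof -
    have "(\<Sum>u\<in>?C. ?\<pi> u u) = (\<Sum>u\<in>?C. ?c * (real (\<beta> - \<alpha>) / real (\<beta> - 1)))"
      using notC arc_irrefl
      by (intro sum.cong) (auto simp: edge_plan_def edge_weight_def common_neighbors_def)
    then show ?thesis
      using xy card by (simp add: edge_plan_def)
  qed
  also have "\<dots> = (\<Sum>u\<in>insert x (insert y ?C). ?\<pi> u u)"
    using finC notC xy by simp
  also have "\<dots> \<le> (\<Sum>u\<in>?V. ?\<pi> u u)"
    using pair_finite_verts V subC coupling_nonneg[OF edge_plan_coupling[OF arc p]]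
    by (intro sum_mono2) auto
  finally have diag: "3 * ?c \<le> (\<Sum>u\<in>?V. ?\<pi> u u)" .
  have "transport_cost G ?\<pi> = (\<Sum>u\<in>?V. \<Sum>v\<in>?V. real (gdist G u v) * ?\<pi> u v)"
    unfolding transport_cost_def by (rule sum.swap)
  also have "\<dots> = (\<Sum>u\<in>?V. (\<Sum>v\<in>?V. ?\<pi> u v) - ?\<pi> u u)"
    using pair_finite_verts by (intro sum.cong) (simp_all add: unit sum_subtractf)
  also have "\<dots> = (\<Sum>u\<in>?V. lazy_measure G p x u) - (\<Sum>u\<in>?V. ?\<pi> u u)"
    using edge_plan_row[OF arc] by (simp add: sum_subtractf)
  finally show ?thesis
    using diag sum_lazy_measure[OF arc] by simp
qed

end

theorem theorem1p3:
  fixes G :: "'a pair_pre_digraph" and n d \<alpha> \<beta> :: nat and x y :: 'a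
  assumes "amply_regular G n d \<alpha> \<beta>"
    and "Digraph_Component.connected (with_proj G)"
    and "\<beta> > \<alpha>" and "\<alpha> \<ge> 1"
    and "(x, y) \<in> parcs G"
  shows "lly_curvature G x y \<ge> 3 / real d"
proof -
  interpret pair_graph G
    using assms(1) by (simp add: amply_regular_def)
  interpret amply_regular_graph G n d \<alpha> \<beta>
    using assms by unfold_locales
  note arc = \<open>(x, y) \<in> parcs G\<close>
  have "out_degree (with_proj G) x = d"
    using assms(1) arc wellformed' by (auto simp: amply_regular_def)
  then have d: "d > 0"
    using out_degree_pos[OF arc] by simp
  show ?thesis
  \<comment> \<open>The arc forces d > 0, so the threshold 1/(d + 1) for the plan lies below 1 and
    the estimate holds on a left neighborhood of 1.\<close>
  proof (rule lly_curvature_ge[OF arc])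
    show "1 / (real d + 1) < 1"
      using d by simp
  next
    fix p assume p: "1 / (real d + 1) \<le> p" "p < 1"
    note plan = edge_plan_coupling[OF arc p]
    from plan show "couplings G (lazy_measure G p x) (lazy_measure G p y) \<noteq> {}"
      by blast
    have "wasserstein G (lazy_measure G p x) (lazy_measure G p y) \<le> 1 - 3 * (1 - p) / real d"
      using wasserstein_le[OF plan] edge_plan_cost[OF arc p] by linarith
    then show "3 / real d \<le> ollivier_curvature G p x y / (1 - p)"
      using p gdist_arc[OF arc] by (simp add: ollivier_curvature_def field_simps)
  qed
qed

end
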